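(* Let $\mathcal{X}$ be a separable Banach space with a Borel probability measure $\mu_0$ (the prior), let $\mathcal{D}$ be a metric space, let $\Gamma\in\mathbb{R}^{p\times p}$ be a symmetric positive definite matrix, and consider the inverse problem $y=\mathcal{G}(x;d)+\epsilon$ with $x\in\mathcal{X}$, $y,\epsilon\in\mathbb{R}^p$, Gaussian noise $\epsilon\sim\mathcal{N}(0,\Gamma)$, an observation operator $\mathcal{G}:\mathcal{X}\times\mathcal{D}\to\mathbb{R}^p$ and surrogates $\mathcal{G}_N:\mathcal{X}\times\mathcal{D}\to\mathbb{R}^p$, $N\in\mathbb{N}$. Let $U$ and $U_N$ be the expected information gains associated with $\mathcal{G}$ and $\mathcal{G}_N$ (defined in the context). Assume: (i) there exists a constant $C_G>0$ such that for all $N\in\mathbb{N}$ $$\sup_{d\in\mathcal{D}}\int_{\mathcal{X}}\|\mathcal{G}(x;d)\|_\Gamma^4\,d\mu_0(x)\le C_G,\qquad \sup_{d\in\mathcal{D}}\int_{\mathcal{X}}\|\mathcal{G}_N(x;d)\|_\Gamma^4\,d\mu_0(x)\le C_G;$$ (ii) there exist $C_1>0$ and $\psi:\mathbb{N}\to\mathbb{R}_+$ with $\psi(N)\to0$ as $N\to\infty$ such that for all $d\in\mathcal{D}$ and $N\in\mathbb{N}$ $$\mathbb{E}^{\mu_0}\|\mathcal{G}(X;d)-\mathcal{G}_N(X;d)\|_\Gamma^2<C_1\psi(N);$$ (iii) $\mathcal{G}$ is a continuous function in $d\in\mathcal{D}$ (i.e. $d\mapsto\mathcal{G}(x;d)$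 is continuous for each $x\in\mathcal{X}$). Then there exists $C>0$ such that $$\sup_{d\in\mathcal{D}}|U(d)-U_N(d)|\le C\sqrt{\psi(N)}$$ for all $N$ sufficiently large. Moreover, if $\{d_N^*\}_{N=1}^\infty$ is a sequence with $d_N^*\in\operatorname{arg\,max}_{d\in\mathcal{D}}U_N(d)$ for each $N$, then the limit of any converging subsequence of $\{d_N^*\}$ is a maximizer of $U$ over $\mathcal{D}$.
   Context: $\|v\|_\Gamma=\|\Gamma^{-1/2}v\|$ is the $\Gamma$-weighted Euclidean norm on $\mathbb{R}^p$; $\mathbb{E}^{\mu_0}$ is expectation over $X\sim\mu_0$. The maps $\mathcal{G}(\cdot;d)$ and $\mathcal{G}_N(\cdot;d)$ are measurable for each $d$. Let $\pi(\cdot|x;d)$ and $\pi_N(\cdot|x;d)$ be the Lebesgue densities of $\mathcal{N}(\mathcal{G}(x;d),\Gamma)$ and $\mathcal{N}(\mathcal{G}_N(x;d),\Gamma)$, and let $\pi(y;d)=\int_{\mathcal{X}}\pi(y|x;d)\,d\mu_0(x)$, $\pi_N(y;d)=\int_{\mathcal{X}}\pi_N(y|x;d)\,d\mu_0(x)$. The expected information gains are $$U(d)=\int_{\mathbb{R}^p}\int_{\mathcal{X}}\log\left(\frac{\pi(y|x;d)}{\pi(y;d)}\right)\pi(y|x;d)\,d\mu_0(x)\,dy,\qquad U_N(d)=\int_{\mathbb{R}^p}\int_{\mathcal{X}}\log\left(\frac{\pi_N(y|x;d)}{\pi_N(y;d)}\right)\pi_N(y|x;d)\,d\mu_0(x)\,dy.$$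 *)

theory Defs
  imports "HOL-Probability.Probability"
begin

definition spd_matrix :: "real^'p^'p \<Rightarrow> bool" where
  "spd_matrix A \<longleftrightarrow> transpose A = A \<and> (\<forall>v. v \<noteq> 0 \<longrightarrow> v \<bullet> (A *v v) > 0)"

text \<open>
  The principal square root; existence and uniqueness, and hence the usefulness of the
  definite description, hold for symmetric positive definite arguments only.
\<close>
definition spd_sqrt :: "real^'p^'p \<Rightarrow> real^'p^'p" where
  "spd_sqrt A = (THE S. spd_matrix S \<and> S ** S = A)"

definition weighted_norm :: "real^'p^'p \<Rightarrow> real^'p \<Rightarrow> real" where
  "weighted_norm \<Gamma> v = norm (matrix_inv (spd_sqrt \<Gamma>) *v v)"

definition gaussian_density :: "real^'p \<Rightarrow> real^'p^'p \<Rightarrow> real^'p \<Rightarrow> real" where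
  "gaussian_density m \<Gamma> y =
     exp (- ((y - m) \<bullet> (matrix_inv \<Gamma> *v (y - m))) / 2) / sqrt ((2 * pi) ^ CARD('p) * det \<Gamma>)"

text \<open>
  Below, \<open>H x d\<close> is the forward map, to be instantiated with an observation operator or with
  one of its surrogates, and \<open>\<mu>\<close> is the prior.
\<close>
definition likelihood ::
  "real^'p^'p \<Rightarrow> ('x \<Rightarrow> 'd \<Rightarrow> real^'p) \<Rightarrow> real^'p \<Rightarrow> 'x \<Rightarrow> 'd \<Rightarrow> real" where
  "likelihood \<Gamma> H y x d = gaussian_density (H x d) \<Gamma> y"

definition evidence ::
  "'x measure \<Rightarrow> real^'p^'p \<Rightarrow> ('x \<Rightarrow> 'd \<Rightarrow> real^'p) \<Rightarrow> real^'p \<Rightarrow> 'd \<Rightarrow> real" where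
  "evidence \<mu> \<Gamma> H y d = (\<integral>x. likelihood \<Gamma> H y x d \<partial>\<mu>)"

definition expected_information_gain ::
  "'x measure \<Rightarrow> real^'p^'p \<Rightarrow> ('x \<Rightarrow> 'd \<Rightarrow> real^'p) \<Rightarrow> 'd \<Rightarrow> real" where
  "expected_information_gain \<mu> \<Gamma> H d =
     (\<integral>y. (\<integral>x. ln (likelihood \<Gamma> H y x d / evidence \<mu> \<Gamma> H y d) * likelihood \<Gamma> H y x d \<partial>\<mu>) \<partial>lborel)"

end

theory Submission
  imports Defs
begin

text \<open>
  Up to a constant independent of \<open>G\<close>, the expected information gain is the entropy of the
  observation \<open>Y = G(X) + \<epsilon>\<close>, whose density \<open>p\<close> is a Gaussian mixture. By Gibbs' inequality the
  entropy of \<open>Y' = K(X) + \<epsilon>\<close> exceeds that of \<open>Y\<close> by at most the expectation of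
  \<open>ln p(Y) - ln p(Y')\<close>, where both observations carry the same noise. Jensen's inequality under
  the posterior bounds \<open>ln p(y) - ln p(y')\<close> by \<open>(1 + s)/2 \<parallel>y - y'\<parallel>\<^sup>2\<close> plus \<open>1/(2s)\<close> times the
  posterior mean of \<open>\<parallel>y - G(X)\<parallel>\<^sup>2\<close>, and averaged over \<open>Y\<close> the latter is just the energy of the
  noise. With \<open>r\<close> the mean square distance of \<open>G\<close> and \<open>K\<close>, the choice \<open>s = 1 / sqrt r\<close> gives the
  rate. The same estimate makes \<open>U\<close> continuous: bounded fourth moments turn the pointwise
  convergence of \<open>G(x; d\<^sub>n)\<close> into convergence in mean square.
\<close>

subsection \<open>The square root of a positive definite matrix\<close>

text \<open>Maximise \<open>x \<bullet> f x\<close> over the compact unit sphere of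
  \<open>S\<close>. At a maximiser \<open>v\<close> the residual \<open>w = f v - l v\<close> is a
  direction inside \<open>S\<close> orthogonal to \<open>v\<close>, so the form cannot grow to first
  order along it. By symmetry that first-order term is proportional to \<open>w \<bullet> w\<close>,
  hence \<open>w = 0\<close>.\<close>

lemma symmetric_eigenvector:
  fixes f :: "'a::euclidean_space \<Rightarrow> 'a"
  assumes f: "linear f" and sym: "\<And>x y. f x \<bullet> y = x \<bullet> f y"
    and S: "subspace S" "S \<noteq> {0}" "f ` S \<subseteq> S"
  obtains v l where "v \<in> S" "norm v = 1" "f v = l *\<^sub>R v"
proof -
  let ?K = "sphere 0 1 \<inter> S"
  obtain u where u: "u \<in> S" "u \<noteq> 0"
    using S subspace_0 by blast
  have "(1 / norm u) *\<^sub>R u \<in> ?K"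
    using u S(1) by (auto intro: subspace_scale)
  then have "?K \<noteq> {}" by blast
  moreover have "compact ?K"
    using S(1) by (simp add: closed_subspace compact_Int_closed)
  moreover have "continuous_on ?K (\<lambda>x. x \<bullet> f x)"
    using f by (intro continuous_intros linear_continuous_on) (simp add: linear_conv_bounded_linear)
  ultimately obtain v where v: "v \<in> ?K" and max: "\<And>x. x \<in> ?K \<Longrightarrow> x \<bullet> f x \<le> v \<bullet> f v"
    using continuous_attains_sup by metis
  define l where "l = v \<bullet> f v"
  have vv: "v \<bullet> v = 1" and vS: "v \<in> S"
    using v by (auto simp: norm_eq_1)
  have max': "x \<bullet> f x \<le> l * (x \<bullet> x)" if "x \<in> S" for x
  proof (cases "x = 0")
    case False
    then have "(1 / norm x) *\<^sub>R x \<in> ?K"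
      using that S(1) by (auto intro: subspace_scale)
    from max[OF this] have "(x \<bullet> f x) / (norm x)\<^sup>2 \<le> l"
      by (simp add: l_def linear_scale[OF f] power2_eq_square)
    then show ?thesis
      using False by (simp add: divide_simps dot_square_norm split: if_splits)
  qed (simp add: linear_0[OF f])
  define w where "w = f v - l *\<^sub>R v"
  have wS: "w \<in> S"
    using S vS by (auto simp: w_def intro!: subspace_diff subspace_scale)
  have wv: "w \<bullet> v = 0"
    by (simp add: w_def inner_diff_left vv l_def inner_commute[of "f v"])
  \<comment> \<open>These are the coefficients in \<open>t\<close> of the form
    \<open>x \<bullet> f x - l * (x \<bullet> x)\<close> at \<open>v + t w\<close>. The form is
    nonpositive on \<open>S\<close> and vanishes at \<open>v\<close>; symmetry merges the two mixed
    terms into \<open>2 * t * a\<close>.\<close>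
  define a b where "a = f v \<bullet> w" and "b = w \<bullet> f w - l * (w \<bullet> w)"
  have quad: "2 * t * a + t\<^sup>2 * b \<le> 0" for t
  proof -
    have "v + t *\<^sub>R w \<in> S"
      using S(1) vS wS by (intro subspace_add subspace_scale)
    from max'[OF this] show ?thesis
      using wv vv sym[of v w]
      by (simp add: linear_add[OF f] linear_scale[OF f] inner_add_left inner_add_right
            a_def b_def l_def inner_commute algebra_simps power2_eq_square)
  qed
  have "a = 0"
  proof (rule ccontr)
    assume "a \<noteq> 0"
    \<comment> \<open>Small enough for the linear term to win: \<open>2 * t * a\<close> equals
      \<open>2 * t\<^sup>2 * (\<bar>b\<bar> + 1)\<close>, which outweighs
      \<open>t\<^sup>2 * b\<close> whatever the sign of \<open>b\<close>.\<close>
    define t where "t = a / (\<bar>b\<bar> + 1)"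
    have "t\<^sup>2 * (2 * (\<bar>b\<bar> + 1) + b) \<le> 0"
    proof -
      have "a = t * (\<bar>b\<bar> + 1)" by (simp add: t_def)
      then show ?thesis
        using quad[of t] by (simp add: algebra_simps power2_eq_square)
    qed
    moreover have "t\<^sup>2 > 0" "2 * (\<bar>b\<bar> + 1) + b > 0"
      using \<open>a \<noteq> 0\<close> by (auto simp: t_def)
    ultimately show False
      by (meson mult_pos_pos not_le)
  qed
  then have "w \<bullet> w = 0"
    using wv by (simp add: a_def w_def inner_diff_left inner_diff_right inner_commute)
  then have "f v = l *\<^sub>R v"
    by (simp add: w_def)
  moreover have "norm v = 1"
    using v by auto
  ultimately show ?thesis
    using that vS by blast
qed

text \<open>Induction on the dimension: split off one unit eigenvector \<open>v\<close> and continue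
  in its orthogonal complement inside \<open>S\<close>. Symmetry keeps the complement invariant,
  since \<open>v \<bullet> f x = f v \<bullet> x\<close> is a multiple of
  \<open>v \<bullet> x\<close>. Working with invariant subspaces lets the induction pass to the
  complement.\<close>

lemma symmetric_eigenbasis_subspace:
  fixes f :: "'a::euclidean_space \<Rightarrow> 'a"
  assumes f: "linear f" and sym: "\<And>x y. f x \<bullet> y = x \<bullet> f y"
    and S: "subspace S" "f ` S \<subseteq> S"
  shows "\<exists>B l. finite B \<and> pairwise orthogonal B \<and> (\<forall>b\<in>B. norm b = 1 \<and> f b = l b *\<^sub>R b) \<and> span B = S"
  using S
proof (induction "dim S" arbitrary: S rule: less_induct)
  case less
  show ?case
  proof (cases "S = {0}")
    case True
    then show ?thesis by (intro exI[of _ "{}"]) (auto simp: pairwise_def)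
  next
    case False
    with less.prems obtain v c where v: "v \<in> S" "norm v = 1" "f v = c *\<^sub>R v"
      using symmetric_eigenvector[OF f sym] by metis
    define T where "T = {x \<in> S. v \<bullet> x = 0}"
    have T: "subspace T"
      using less.prems(1) unfolding T_def subspace_def by (auto simp: inner_add_right)
    have fT: "f ` T \<subseteq> T"
      using less.prems(2) by (auto simp: T_def v(3) simp flip: sym)
    have "v \<notin> T"
      using v by (auto simp: T_def norm_eq_1)
    then have "T \<subset> S"
      using v unfolding T_def by blast
    then have "dim T < dim S"
      using T less.prems(1) by (metis dim_psubset span_eq_iff)
    from less.hyps[OF this T fT] obtain B l where
      B: "finite B" "pairwise orthogonal B" "\<forall>b\<in>B. norm b = 1 \<and> f b = l b *\<^sub>R b" "span B = T"
      by blast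
    have BT: "B \<subseteq> T" using B(4) span_superset by blast
    with \<open>v \<notin> T\<close> have vB: "v \<notin> B" by blast
    have "S \<subseteq> span (insert v B)"
    proof
      fix x assume x: "x \<in> S"
      have "x - (v \<bullet> x) *\<^sub>R v \<in> T"
        using x v less.prems(1)
        by (auto simp: T_def inner_diff_right norm_eq_1 intro!: subspace_diff subspace_scale)
      then show "x \<in> span (insert v B)"
        unfolding span_insert B(4) by blast
    qed
    moreover have "span (insert v B) \<subseteq> S"
      using v BT less.prems(1) by (intro span_minimal) (auto simp: T_def)
    moreover have "pairwise orthogonal (insert v B)"
      using B(2) BT by (auto simp: pairwise_insert T_def orthogonal_def inner_commute)
    ultimately show ?thesis
      using B v vB by (intro exI[of _ "insert v B"] exI[of _ "l(v := c)"]) auto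
  qed
qed

text \<open>The root is the matrix of the map \<open>h\<close> that has the same orthonormal
  eigenbasis as \<open>\<Gamma>\<close> and the square roots of its eigenvalues, which are positive
  because \<open>\<Gamma>\<close> is positive definite.\<close>

lemma spd_sqrt_exists:
  fixes \<Gamma> :: "real^'p^'p"
  assumes "spd_matrix \<Gamma>"
  shows "\<exists>S. spd_matrix S \<and> S ** S = \<Gamma>"
proof -
  let ?f = "\<lambda>v. \<Gamma> *v v"
  have sym: "?f x \<bullet> y = x \<bullet> ?f y" for x y
    using assms by (metis dot_lmul_matrix spd_matrix_def transpose_matrix_vector)
  obtain B l where B: "finite B" "pairwise orthogonal B" "\<And>b. b \<in> B \<Longrightarrow> norm b = 1"
      "\<And>b. b \<in> B \<Longrightarrow> ?f b = l b *\<^sub>R b" "span B = UNIV"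
    using symmetric_eigenbasis_subspace[of ?f UNIV] sym
    by (metis matrix_vector_mul_linear subspace_UNIV subset_UNIV)
  have l: "l b > 0" if "b \<in> B" for b
  proof -
    have "b \<bullet> ?f b > 0"
      using assms B(3)[OF that] by (metis norm_zero spd_matrix_def zero_neq_one)
    then show ?thesis
      using B(3,4)[OF that] by (simp add: norm_eq_1)
  qed
  have expand: "(\<Sum>b\<in>B. (x \<bullet> b) *\<^sub>R b) = x" for x
    using B by (intro orthonormal_basis_expand) auto
  have orth: "b \<bullet> b' = (if b = b' then 1 else 0)" if "b \<in> B" "b' \<in> B" for b b'
    using B(2,3) that by (auto simp: norm_eq_1 pairwise_def orthogonal_def)
  define h where "h x = (\<Sum>b\<in>B. (sqrt (l b) * (x \<bullet> b)) *\<^sub>R b)" for x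
  have h: "linear h"
    unfolding h_def
    by (intro linearI) (simp_all add: inner_add_left algebra_simps sum.distrib scaleR_sum_right)
  have hb: "h x \<bullet> b = sqrt (l b) * (x \<bullet> b)" if "b \<in> B" for x b
  proof -
    have "h x \<bullet> b = (\<Sum>b'\<in>B. if b' = b then sqrt (l b) * (x \<bullet> b) else 0)"
      unfolding h_def inner_sum_left using that by (intro sum.cong) (auto simp: orth)
    then show ?thesis using that B(1) by simp
  qed
  have hh: "h (h x) = ?f x" for x
  proof -
    have "h (h x) = (\<Sum>b\<in>B. (x \<bullet> b) *\<^sub>R (l b *\<^sub>R b))"
      unfolding h_def[of "h x"] using hb l
      by (intro sum.cong) (auto simp: less_imp_le ac_simps simp flip: mult.assoc)
    also have "\<dots> = (\<Sum>b\<in>B. (x \<bullet> b) *\<^sub>R ?f b)"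
      using B(4) by simp
    also have "\<dots> = ?f (\<Sum>b\<in>B. (x \<bullet> b) *\<^sub>R b)"
      by (simp add: matrix_vector_mult_scaleR linear_sum[OF matrix_vector_mul_linear])
    finally show ?thesis by (simp add: expand)
  qed
  have hin: "h x \<bullet> y = (\<Sum>b\<in>B. sqrt (l b) * (x \<bullet> b) * (y \<bullet> b))" for x y
    unfolding h_def inner_sum_left by (simp add: inner_commute)
  have "transpose (matrix h) = matrix h"
  proof -
    have "adjoint h = h"
      by (rule adjoint_unique) (simp add: hin inner_commute[of _ "h _"] mult.commute mult.left_commute)
    then show ?thesis using matrix_adjoint[OF h] by simp
  qed
  moreover have "v \<bullet> (matrix h *v v) > 0" if "v \<noteq> 0" for v
  proof -
    have "\<exists>b\<in>B. v \<bullet> b \<noteq> 0"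
      using that expand[of v] by (metis (no_types, lifting) scale_eq_0_iff sum.neutral)
    then obtain b where "b \<in> B" "v \<bullet> b \<noteq> 0" by blast
    then have "(\<Sum>b\<in>B. sqrt (l b) * (v \<bullet> b)\<^sup>2) > 0"
      using l B(1) by (intro sum_pos2[of B b]) (auto simp: less_imp_le)
    then show ?thesis
      using h by (simp add: matrix_works inner_commute[of v] hin power2_eq_square mult.assoc)
  qed
  moreover have "matrix h ** matrix h = \<Gamma>"
    using h hh by (simp add: matrix_eq matrix_works flip: matrix_vector_mul_assoc)
  ultimately show ?thesis
    unfolding spd_matrix_def by blast
qed

text \<open>With \<open>D = S - T\<close>, equality of the squares reads
  \<open>S ** D + D ** T = 0\<close>. Multiplying by \<open>D\<close> from the left and taking
  traces gives \<open>trace (D ** (S ** D)) + trace (D ** (T ** D)) = 0\<close>. Both traces are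
  sums of values of positive definite forms at the columns of \<open>D\<close>, so every column
  vanishes.\<close>

lemma spd_sqrt_unique:
  fixes S T :: "real^'p^'p"
  assumes S: "spd_matrix S" and T: "spd_matrix T" and eq: "S ** S = T ** T"
  shows "S = T"
proof -
  define D where "D = S - T"
  have D: "transpose D = D"
    using S T by (simp add: D_def spd_matrix_def transpose_def vec_eq_iff)
  have form: "trace (D ** (M ** D)) = (\<Sum>i\<in>UNIV. column i D \<bullet> (M *v column i D))" for M
  proof -
    have "(D ** (M ** D)) $ i $ i = column i D \<bullet> (M *v column i D)" for i
    proof -
      have "row i D = column i D"
        by (metis D row_transpose)
      then show ?thesis
        by (simp add: matrix_matrix_mult_def matrix_vector_mult_def inner_vec_def row_def column_def vec_eq_iff)
    qed
    then show ?thesis by (simp add: trace_def)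
  qed
  have nonneg: "0 \<le> v \<bullet> (M *v v)" if "spd_matrix M" for M :: "real^'p^'p" and v
    using that by (cases "v = 0") (auto simp: spd_matrix_def less_imp_le)
  have "S ** D + D ** T = 0"
    using eq by (simp add: D_def matrix_eq matrix_vector_mult_add_rdistrib matrix_vector_mult_diff_rdistrib
        matrix_vector_mult_diff_distrib flip: matrix_vector_mul_assoc)
  moreover have "D ** 0 = 0"
    by (simp add: vec_eq_iff matrix_matrix_mult_def)
  ultimately have "D ** (S ** D) + D ** (D ** T) = 0"
    by (metis matrix_add_ldistrib)
  then have "trace (D ** (S ** D)) + trace (D ** (D ** T)) = 0"
    by (metis trace_0 trace_add mat_0)
  then have "trace (D ** (S ** D)) + trace (D ** (T ** D)) = 0"
    using trace_mul_sym[of D "D ** T"] by (simp add: matrix_mul_assoc)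
  then have "trace (D ** (S ** D)) = 0"
    unfolding form using nonneg[OF S] nonneg[OF T]
    by (smt (verit, best) sum_nonneg)
  then have "column i D \<bullet> (S *v column i D) = 0" for i
    unfolding form using nonneg[OF S] by (subst (asm) sum_nonneg_eq_0_iff) auto
  then have "column i D = 0" for i
    using S unfolding spd_matrix_def by (metis less_irrefl)
  then have "D = 0"
    by (simp add: column_def vec_eq_iff)
  then show ?thesis by (simp add: D_def)
qed

lemma spd_sqrt:
  assumes "spd_matrix \<Gamma>"
  shows "spd_matrix (spd_sqrt \<Gamma>)" "spd_sqrt \<Gamma> ** spd_sqrt \<Gamma> = \<Gamma>"
proof -
  have "\<exists>!S. spd_matrix S \<and> S ** S = \<Gamma>"
    using spd_sqrt_exists[OF assms] spd_sqrt_unique by blast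
  from theI'[OF this] show "spd_matrix (spd_sqrt \<Gamma>)" "spd_sqrt \<Gamma> ** spd_sqrt \<Gamma> = \<Gamma>"
    unfolding spd_sqrt_def by auto
qed

section \<open>Inverse matrices and the weighted norm\<close>

lemma spd_matrix_invertible:
  assumes "spd_matrix A"
  shows "invertible A"
proof -
  have "A *v v = 0 \<Longrightarrow> v = 0" for v
    using assms unfolding spd_matrix_def by (metis inner_zero_right less_irrefl)
  then show ?thesis
    by (simp add: invertible_left_inverse matrix_left_invertible_ker)
qed

lemma matrix_inv_inverse:
  fixes A :: "'a::field^'n^'n"
  assumes "invertible A"
  shows "A ** matrix_inv A = mat 1" "matrix_inv A ** A = mat 1"
  using someI_ex[OF assms[unfolded invertible_def]] unfolding matrix_inv_def by auto

lemma matrix_inv_eqI: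
  fixes A :: "'a::field^'n^'n"
  assumes "A ** B = mat 1"
  shows "matrix_inv A = B"
  by (metis assms invertible_right_inverse matrix_inv_inverse(2) matrix_mul_assoc matrix_mul_lid matrix_mul_rid)

text \<open>Identifies the norm of the assumptions with the exponent of
  \<open>gaussian_density\<close>. The inverse of the symmetric root is again symmetric, and its
  square inverts \<open>\<Gamma>\<close>.\<close>

lemma weighted_norm_square:
  assumes "spd_matrix \<Gamma>"
  shows "(weighted_norm \<Gamma> v)\<^sup>2 = v \<bullet> (matrix_inv \<Gamma> *v v)"
proof -
  define S where "S = spd_sqrt \<Gamma>"
  have S: "spd_matrix S" "S ** S = \<Gamma>"
    using spd_sqrt[OF assms] by (simp_all add: S_def)
  note inv = matrix_inv_inverse[OF spd_matrix_invertible[OF S(1)]]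
  have "S ** transpose (matrix_inv S) = transpose (matrix_inv S ** S)"
    using S(1) by (simp add: matrix_transpose_mul spd_matrix_def)
  then have "transpose (matrix_inv S) = matrix_inv S"
    by (metis inv(2) matrix_inv_eqI transpose_mat)
  then have "(weighted_norm \<Gamma> v)\<^sup>2 = v \<bullet> ((matrix_inv S ** matrix_inv S) *v v)"
    unfolding weighted_norm_def S_def[symmetric]
    by (metis dot_lmul_matrix dot_square_norm matrix_vector_mul_assoc transpose_matrix_vector)
  moreover have "matrix_inv \<Gamma> = matrix_inv S ** matrix_inv S"
    by (rule matrix_inv_eqI) (metis S(2) inv(1) matrix_mul_assoc matrix_mul_rid)
  ultimately show ?thesis by simp
qed

subsection \<open>Gaussian noise of unspecified mass\<close>

lemma power2_sum_le: "(a + b)\<^sup>2 \<le> 2 * a\<^sup>2 + 2 * (b::real)\<^sup>2"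
  using zero_le_power2[of "a - b"] by (simp add: power2_eq_square algebra_simps)

text \<open>The squared norm is a sum over coordinates, so the integral factors into one-dimensional
  ones, each a rescaled normal density.\<close>

lemma integrable_exp_neg_norm_square:
  fixes c :: real
  assumes "c > 0"
  shows "integrable lborel (\<lambda>x::'a::euclidean_space. exp (- (c * (norm x)\<^sup>2)))"
proof -
  have one_dim: "(\<integral>\<^sup>+t. ennreal (exp (- (c * t\<^sup>2))) \<partial>lborel) < \<infinity>"
  proof -
    \<comment> \<open>The standard deviation for which the exponent
      \<open>t\<^sup>2 / (2 * s\<^sup>2)\<close> of the normal density is
      \<open>c * t\<^sup>2\<close>.\<close>
    define s where "s = sqrt (1 / (2 * c))"
    have "integrable lborel (\<lambda>t. sqrt (2 * pi * s\<^sup>2) * normal_density 0 s t)"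
      using assms by (intro integrable_mult_right integrable_normal_density) (simp add: s_def)
    also have "(\<lambda>t. sqrt (2 * pi * s\<^sup>2) * normal_density 0 s t) = (\<lambda>t. exp (- (c * t\<^sup>2)))"
      using assms by (auto simp: normal_density_def s_def field_simps)
    finally show ?thesis
      by (simp add: integrable_iff_bounded)
  qed
  have "exp (- (c * (norm x)\<^sup>2)) = (\<Prod>b\<in>Basis. exp (- (c * (x \<bullet> b)\<^sup>2)))" for x :: 'a
    by (simp add: norm_eq_sqrt_inner euclidean_inner[of x x] sum_nonneg power2_eq_square
        sum_distrib_left sum_negf flip: exp_sum)
  then have "(\<integral>\<^sup>+x. ennreal (exp (- (c * (norm (x::'a))\<^sup>2))) \<partial>lborel)
      = (\<integral>\<^sup>+x. (\<Prod>b\<in>(Basis::'a set). ennreal (exp (- (c * (x \<bullet> b)\<^sup>2)))) \<partial>lborel)"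
    by (simp add: prod_ennreal)
  also have "\<dots> = (\<Prod>b\<in>(Basis::'a set). (\<integral>\<^sup>+t. ennreal (exp (- (c * t\<^sup>2))) \<partial>lborel))"
    by (rule nn_integral_lborel_prod) auto
  also have "\<dots> < \<infinity>"
    using one_dim by (simp add: power_less_top_ennreal)
  finally show ?thesis
    by (simp add: integrable_iff_bounded)
qed

text \<open>The centred Gaussian density without its normalising factor; \<open>A\<close> stands for
  the whitening map, multiplication by the inverse root of the covariance.\<close>

definition gauss :: "('a::euclidean_space \<Rightarrow> 'b::real_normed_vector) \<Rightarrow> 'a \<Rightarrow> real" where
  "gauss A v = exp (- ((norm (A v))\<^sup>2 / 2))"

text \<open>Injectivity bounds \<open>norm (A v)\<close> below by a positive multiple of
  \<open>norm v\<close>, which makes the kernel integrable.\<close>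

locale noise =
  fixes A :: "'a::euclidean_space \<Rightarrow> 'b::euclidean_space"
  assumes linear_A: "linear A" and inj_A: "inj A"
begin

lemma measurable_A [measurable]: "A \<in> borel_measurable borel"
  using linear_A by (simp add: borel_measurable_continuous_onI linear_continuous_on linear_conv_bounded_linear)

lemma measurable_gauss [measurable]: "gauss A \<in> borel_measurable borel"
  unfolding gauss_def[abs_def] by measurable

lemma gauss_pos: "gauss A v > 0" and gauss_le_1: "gauss A v \<le> 1"
  by (simp_all add: gauss_def)

text \<open>Half of the Gaussian decay absorbs the quadratic factor, by \<open>t \<le> exp t\<close>
  at a quarter of the squared norm. This yields both a uniform bound and integrability of the
  second-moment kernel.\<close>

lemma square_mult_gauss_le: "(norm (A v))\<^sup>2 * gauss A v \<le> 4 * exp (- ((norm (A v))\<^sup>2 / 4))"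
proof -
  define t where "t = (norm (A v))\<^sup>2 / 4"
  have "t * exp (- (2 * t)) \<le> exp t * exp (- (2 * t))"
    using exp_ge_add_one_self[of t] by (intro mult_right_mono) (linarith, simp)
  also have "\<dots> = exp (- t)" by (simp flip: exp_add)
  finally show ?thesis by (simp add: gauss_def t_def)
qed

lemma integrable_exp_square: "c > 0 \<Longrightarrow> integrable lborel (\<lambda>v. exp (- (c * (norm (A v))\<^sup>2)))"
proof -
  assume c: "c > 0"
  obtain B where B: "B > 0" "\<And>v. B * norm v \<le> norm (A v)"
    using linear_inj_bounded_below_pos[OF linear_A inj_A] by blast
  have "c * B\<^sup>2 * (norm v)\<^sup>2 \<le> c * (norm (A v))\<^sup>2" for v
    using c B(1) power_mono[OF B(2), of v 2] by (simp add: power_mult_distrib mult.assoc)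
  then show ?thesis
    using c B(1)
    by (intro Bochner_Integration.integrable_bound[OF integrable_exp_neg_norm_square[of "c * B\<^sup>2"]]) auto
qed

lemma integrable_gauss: "integrable lborel (gauss A)"
  using integrable_exp_square[of "1/2"] by (simp add: gauss_def[abs_def])

lemma integrable_square_gauss: "integrable lborel (\<lambda>v. (norm (A v))\<^sup>2 * gauss A v)"
  using gauss_pos square_mult_gauss_le
  by (intro Bochner_Integration.integrable_bound[OF integrable_mult_right[OF integrable_exp_square[of "1/4"], of 4]])
    (auto simp: less_imp_le abs_mult)

end

section \<open>The law of a signal with additive noise\<close>

lemma nn_integral_lborel_translate:
  fixes f :: "'a::euclidean_space \<Rightarrow> ennreal"
  assumes [measurable]: "f \<in> borel_measurable borel"
  shows "(\<integral>\<^sup>+y. f (y + c) \<partial>lborel) = (\<integral>\<^sup>+y. f y \<partial>lborel)"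
proof -
  have "(\<integral>\<^sup>+y. f y \<partial>lborel) = (\<integral>\<^sup>+y. f y \<partial>distr lborel borel ((+) c))"
    by (simp add: lborel_distr_plus)
  then show ?thesis
    by (simp add: nn_integral_distr add.commute)
qed

text \<open>Fubini and translation invariance of Lebesgue measure. The noise density
  \<open>h\<close> is arbitrary of finite mass because it is used twice: with the Gaussian kernel,
  and with that kernel weighted by the squared norm.\<close>

lemma (in sigma_finite_measure) distr_signal_plus_noise:
  fixes G :: "'a \<Rightarrow> 'b::euclidean_space" and h :: "'b \<Rightarrow> ennreal"
  assumes [measurable]: "G \<in> borel_measurable M" "h \<in> borel_measurable borel"
    and fin: "(\<integral>\<^sup>+e. h e \<partial>lborel) < \<infinity>"
  shows "distr (M \<Otimes>\<^sub>M density lborel h) borel (\<lambda>(x, e). G x + e)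
    = density lborel (\<lambda>y. \<integral>\<^sup>+x. h (y - G x) \<partial>M)"
proof (rule measure_eqI)
  interpret h: finite_measure "density lborel h"
    using fin by (intro finite_measureI) (simp add: emeasure_density)
  interpret P: pair_sigma_finite M lborel ..
  fix S assume "S \<in> sets (distr (M \<Otimes>\<^sub>M density lborel h) borel (\<lambda>(x, e). G x + e))"
  then have [measurable]: "S \<in> sets borel" by simp
  have "emeasure (distr (M \<Otimes>\<^sub>M density lborel h) borel (\<lambda>(x, e). G x + e)) S
      = (\<integral>\<^sup>+z. indicator S (G (fst z) + snd z) \<partial>(M \<Otimes>\<^sub>M density lborel h))"
    by (simp add: nn_integral_distr split_beta' flip: nn_integral_indicator)
  also have "\<dots> = (\<integral>\<^sup>+x. \<integral>\<^sup>+e. indicator S (G x + e) \<partial>density lborel h \<partial>M)"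
    by (subst h.nn_integral_fst[symmetric]) auto
  also have "\<dots> = (\<integral>\<^sup>+x. \<integral>\<^sup>+e. h e * indicator S (G x + e) \<partial>lborel \<partial>M)"
    by (intro nn_integral_cong) (simp add: nn_integral_density)
  also have "\<dots> = (\<integral>\<^sup>+x. \<integral>\<^sup>+y. h (y - G x) * indicator S y \<partial>lborel \<partial>M)"
  proof (rule nn_integral_cong)
    fix x
    show "(\<integral>\<^sup>+e. h e * indicator S (G x + e) \<partial>lborel) = (\<integral>\<^sup>+y. h (y - G x) * indicator S y \<partial>lborel)"
      using nn_integral_lborel_translate[of "\<lambda>y. h (y - G x) * indicator S y" "G x"]
      by (simp add: add.commute)
  qed
  also have "\<dots> = (\<integral>\<^sup>+y. \<integral>\<^sup>+x. h (y - G x) * indicator S y \<partial>M \<partial>lborel)"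
    by (rule P.Fubini'[symmetric]) measurable
  also have "\<dots> = emeasure (density lborel (\<lambda>y. \<integral>\<^sup>+x. h (y - G x) \<partial>M)) S"
    by (simp add: emeasure_density nn_integral_multc)
  finally show "emeasure (distr (M \<Otimes>\<^sub>M density lborel h) borel (\<lambda>(x, e). G x + e)) S
    = emeasure (density lborel (\<lambda>y. \<integral>\<^sup>+x. h (y - G x) \<partial>M)) S" .
qed simp


subsection \<open>Information gain and the entropy of Gaussian mixtures\<close>

locale gaussian_mixture = prob_space M + noise A
  for M :: "'x measure" and A :: "'a::euclidean_space \<Rightarrow> 'b::euclidean_space"
begin

definition noise_measure :: "'a measure" where
  "noise_measure = density lborel (\<lambda>e. ennreal (gauss A e))"

text \<open>The evidence up to the normalising factor of the Gaussian.\<close>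

definition mixture :: "('x \<Rightarrow> 'a) \<Rightarrow> 'a \<Rightarrow> real" where
  "mixture G y = (\<integral>x. gauss A (y - G x) \<partial>M)"

text \<open>Divided by \<open>mixture G y\<close>, this is the posterior mean of the squared
  whitened residual given the observation \<open>y\<close>.\<close>

definition scatter :: "('x \<Rightarrow> 'a) \<Rightarrow> 'a \<Rightarrow> real" where
  "scatter G y = (\<integral>x. (norm (A (y - G x)))\<^sup>2 * gauss A (y - G x) \<partial>M)"

definition noise_mass :: real where
  "noise_mass = (\<integral>e. gauss A e \<partial>lborel)"

definition noise_energy :: real where
  "noise_energy = (\<integral>e. (norm (A e))\<^sup>2 * gauss A e \<partial>lborel)"

text \<open>The expected information gain up to the normalising factor of the Gaussian.\<close>

definition information :: "('x \<Rightarrow> 'a) \<Rightarrow> real" where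
  "information G = (\<integral>y. (\<integral>x. ln (gauss A (y - G x) / mixture G y) * gauss A (y - G x) \<partial>M) \<partial>lborel)"

lemma noise_mass_nonneg: "noise_mass \<ge> 0" and noise_energy_nonneg: "noise_energy \<ge> 0"
  using gauss_pos by (auto simp: noise_mass_def noise_energy_def less_imp_le intro!: Bochner_Integration.integral_nonneg)

lemma sets_noise_measure [measurable_cong, simp]: "sets noise_measure = sets borel"
  by (simp add: noise_measure_def)

lemma nn_integral_gauss: "(\<integral>\<^sup>+e. ennreal (gauss A e) \<partial>lborel) = ennreal noise_mass"
  using integrable_gauss gauss_pos by (simp add: noise_mass_def nn_integral_eq_integral less_imp_le)

lemma finite_noise_measure: "finite_measure noise_measure"
  unfolding noise_measure_def
  by (intro finite_measureI) (simp add: emeasure_density nn_integral_gauss)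

lemma measure_noise_measure: "measure noise_measure (space noise_measure) = noise_mass"
  using noise_mass_nonneg by (simp add: measure_def noise_measure_def emeasure_density nn_integral_gauss)

sublocale noise: finite_measure noise_measure
  by (rule finite_noise_measure)

sublocale joint: pair_sigma_finite M noise_measure ..

lemma integrable_joint_fst:
  fixes f :: "'x \<Rightarrow> real"
  assumes "integrable M f"
  shows "integrable (M \<Otimes>\<^sub>M noise_measure) (\<lambda>(x, e). f x)"
  using assms by (intro joint.Fubini_integrable) (auto simp: measurable_split_conv)

lemma integral_joint_fst:
  fixes f :: "'x \<Rightarrow> real"
  assumes "integrable M f"
  shows "(\<integral>(x, e). f x \<partial>(M \<Otimes>\<^sub>M noise_measure)) = noise_mass * (\<integral>x. f x \<partial>M)"
  using joint.integral_fst'[OF integrable_joint_fst[OF assms]] by (simp add: measure_noise_measure)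

lemma integrable_joint_snd:
  fixes f :: "'a \<Rightarrow> real"
  assumes [measurable]: "f \<in> borel_measurable borel" and "integrable lborel (\<lambda>e. f e * gauss A e)"
  shows "integrable (M \<Otimes>\<^sub>M noise_measure) (\<lambda>(x, e). f e)"
proof -
  have "integrable noise_measure f"
    unfolding noise_measure_def using assms(2) gauss_pos
    by (subst integrable_density) (auto simp: less_imp_le mult.commute)
  then show ?thesis
    by (intro joint.Fubini_integrable) (auto simp: measurable_split_conv)
qed

context
  fixes G :: "'x \<Rightarrow> 'a"
  assumes G [measurable]: "G \<in> borel_measurable M"
begin

lemma integrable_gauss_shift: "integrable M (\<lambda>x. gauss A (y - G x))"
  using gauss_pos gauss_le_1 by (intro integrable_const_bound[of _ 1]) (auto simp: less_imp_le)

lemma integrable_square_gauss_shift: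
  "integrable M (\<lambda>x. (norm (A (y - G x)))\<^sup>2 * gauss A (y - G x))"
\<comment> \<open>The constant 4 is that of \<open>square_mult_gauss_le\<close>, whose exponential
  is at most 1.\<close>
proof (intro integrable_const_bound[of _ 4] AE_I2)
  show "norm ((norm (A (y - G x)))\<^sup>2 * gauss A (y - G x)) \<le> 4" for x
    using square_mult_gauss_le[of "y - G x"] gauss_pos[of "y - G x"]
    by (simp add: abs_mult less_imp_le order.trans)
qed measurable

lemma measurable_mixture [measurable]: "mixture G \<in> borel_measurable borel"
  unfolding mixture_def[abs_def] by measurable

lemma measurable_scatter [measurable]: "scatter G \<in> borel_measurable borel"
  unfolding scatter_def[abs_def] by measurable

lemma mixture_pos: "mixture G y > 0"
proof -
  have "mixture G y \<noteq> 0"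
  proof
    assume "mixture G y = 0"
    then have "AE x in M. gauss A (y - G x) = 0"
      unfolding mixture_def using integrable_gauss_shift gauss_pos
      by (subst (asm) integral_nonneg_eq_0_iff_AE) (auto simp: less_imp_le)
    then have "AE x in M. False"
      by eventually_elim (metis gauss_pos less_irrefl)
    then show False by simp
  qed
  moreover have "mixture G y \<ge> 0"
    unfolding mixture_def using gauss_pos by (intro Bochner_Integration.integral_nonneg) (auto simp: less_imp_le)
  ultimately show ?thesis by simp
qed

lemma mixture_le_1: "mixture G y \<le> 1"
  unfolding mixture_def using integrable_gauss_shift gauss_le_1 by (intro integral_le_const) auto

lemma scatter_nonneg: "scatter G y \<ge> 0"
  unfolding scatter_def using gauss_pos
  by (intro Bochner_Integration.integral_nonneg) (auto simp: less_imp_le)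

text \<open>Transfers integrals against \<open>mixture G\<close> to the product of signal and noise,
  where two observation maps can be compared pointwise under one and the same noise.\<close>

lemma distr_observation:
  "distr (M \<Otimes>\<^sub>M noise_measure) borel (\<lambda>(x, e). G x + e) = density lborel (\<lambda>y. ennreal (mixture G y))"
  unfolding noise_measure_def
  using integrable_gauss_shift gauss_pos
  by (subst distr_signal_plus_noise) (auto simp: nn_integral_gauss nn_integral_eq_integral less_imp_le mixture_def)

lemma integrable_mult_mixture_iff:
  fixes f :: "'a \<Rightarrow> real"
  assumes [measurable]: "f \<in> borel_measurable borel"
  shows "integrable lborel (\<lambda>y. f y * mixture G y)
    \<longleftrightarrow> integrable (M \<Otimes>\<^sub>M noise_measure) (\<lambda>(x, e). f (G x + e))"
proof -
  have "integrable lborel (\<lambda>y. f y * mixture G y)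
      \<longleftrightarrow> integrable (density lborel (\<lambda>y. ennreal (mixture G y))) f"
    using mixture_pos by (subst integrable_density) (auto simp: less_imp_le mult.commute)
  also have "\<dots> \<longleftrightarrow> integrable (M \<Otimes>\<^sub>M noise_measure) (\<lambda>(x, e). f (G x + e))"
    unfolding distr_observation[symmetric] by (subst integrable_distr_eq) (auto simp: split_beta')
  finally show ?thesis .
qed

lemma integral_mult_mixture:
  fixes f :: "'a \<Rightarrow> real"
  assumes [measurable]: "f \<in> borel_measurable borel"
  shows "(\<integral>y. f y * mixture G y \<partial>lborel) = (\<integral>(x, e). f (G x + e) \<partial>(M \<Otimes>\<^sub>M noise_measure))"
proof -
  have "(\<integral>y. f y * mixture G y \<partial>lborel) = (\<integral>y. f y \<partial>density lborel (\<lambda>y. ennreal (mixture G y)))"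
    using mixture_pos by (subst integral_density) (auto simp: less_imp_le mult.commute)
  also have "\<dots> = (\<integral>(x, e). f (G x + e) \<partial>(M \<Otimes>\<^sub>M noise_measure))"
    unfolding distr_observation[symmetric] by (subst integral_distr) (auto simp: split_beta')
  finally show ?thesis .
qed

lemma integrable_mixture: "integrable lborel (mixture G)"
proof -
  have "integrable (M \<Otimes>\<^sub>M noise_measure) (\<lambda>(x, e). 1 :: real)"
    by (rule integrable_joint_fst) simp
  then have "integrable lborel (\<lambda>y. 1 * mixture G y)"
    by (rule integrable_mult_mixture_iff[THEN iffD2, rotated]) simp
  then show ?thesis by simp
qed

lemma integral_mixture: "(\<integral>y. mixture G y \<partial>lborel) = noise_mass"
proof -
  have "(\<integral>y. 1 * mixture G y \<partial>lborel) = (\<integral>(x, e). 1 \<partial>(M \<Otimes>\<^sub>M noise_measure))"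
    by (rule integral_mult_mixture) simp
  also have "\<dots> = noise_mass * (\<integral>x. 1 \<partial>M)"
    by (rule integral_joint_fst) simp
  finally show ?thesis by (simp add: prob_space)
qed

text \<open>The scatter is the density of signal plus noise when the noise kernel is weighted by its
  squared norm. Its integral is thus the mass of a product measure, and the signal contributes the
  factor 1; the value does not depend on \<open>G\<close>.\<close>

lemma nn_integral_scatter: "(\<integral>\<^sup>+y. ennreal (scatter G y) \<partial>lborel) = ennreal noise_energy"
proof -
  define h where "h e = ennreal ((norm (A e))\<^sup>2 * gauss A e)" for e
  have [measurable]: "h \<in> borel_measurable borel"
    unfolding h_def[abs_def] by measurable
  have h: "(\<integral>\<^sup>+e. h e \<partial>lborel) = ennreal noise_energy"
    unfolding h_def noise_energy_def
    using integrable_square_gauss gauss_pos by (intro nn_integral_eq_integral) (auto simp: less_imp_le)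
  interpret h: finite_measure "density lborel h"
    by (intro finite_measureI) (simp add: emeasure_density h)
  have "ennreal (scatter G y) = (\<integral>\<^sup>+x. h (y - G x) \<partial>M)" for y
    unfolding h_def scatter_def using integrable_square_gauss_shift gauss_pos
    by (intro nn_integral_eq_integral[symmetric]) (auto simp: less_imp_le)
  then have "(\<integral>\<^sup>+y. ennreal (scatter G y) \<partial>lborel)
      = emeasure (density lborel (\<lambda>y. \<integral>\<^sup>+x. h (y - G x) \<partial>M)) UNIV"
    by (simp add: emeasure_density)
  also have "\<dots> = emeasure (distr (M \<Otimes>\<^sub>M density lborel h) borel (\<lambda>(x, e). G x + e)) UNIV"
    by (subst distr_signal_plus_noise) (auto simp: h)
  also have "\<dots> = emeasure (M \<Otimes>\<^sub>M density lborel h) (space M \<times> space (density lborel h))"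
    by (subst emeasure_distr) (auto simp: space_pair_measure intro!: arg_cong2[where f=emeasure])
  also have "\<dots> = emeasure M (space M) * emeasure (density lborel h) (space (density lborel h))"
    by (rule h.emeasure_pair_measure_Times) auto
  also have "\<dots> = ennreal noise_energy"
    by (simp add: emeasure_space_1 emeasure_density h)
  finally show ?thesis .
qed

lemma integrable_scatter: "integrable lborel (scatter G)"
  using nn_integral_scatter scatter_nonneg by (intro integrableI_nonneg) auto

lemma integral_scatter: "(\<integral>y. scatter G y \<partial>lborel) = noise_energy"
  using nn_integral_scatter scatter_nonneg noise_energy_nonneg
  by (simp add: integral_eq_nn_integral)

text \<open>Jensen's inequality in tangent form, with half the squared norm of
  \<open>A (y - G x)\<close> bounded by the sum of the squared norms of \<open>A y\<close> and
  \<open>A (G x)\<close>. The quadratic lower bound serves to make the logarithm integrable.\<close>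

lemma ln_mixture_ge:
  assumes "integrable M (\<lambda>x. (norm (A (G x)))\<^sup>2)"
  shows "ln (mixture G y) \<ge> - (norm (A y))\<^sup>2 - (\<integral>x. (norm (A (G x)))\<^sup>2 \<partial>M)"
proof -
  define m where "m = (\<integral>x. (norm (A (G x)))\<^sup>2 \<partial>M)"
  \<comment> \<open>The mean over \<open>x\<close> of the lower bound for the exponent. With the
    tangent taken at this point the linear part averages to zero, and the integral is exactly
    \<open>exp t\<close>.\<close>
  define t where "t = - (norm (A y))\<^sup>2 - m"
  have le: "exp t * (1 - (norm (A y))\<^sup>2 - (norm (A (G x)))\<^sup>2 - t) \<le> gauss A (y - G x)" for x
  proof -
    define u where "u = - ((norm (A (y - G x)))\<^sup>2 / 2)"
    have "(norm (A y - A (G x)))\<^sup>2 \<le> (norm (A y) + norm (A (G x)))\<^sup>2"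
      by (intro power_mono norm_triangle_ineq4) simp
    also have "\<dots> \<le> 2 * (norm (A y))\<^sup>2 + 2 * (norm (A (G x)))\<^sup>2"
      by (rule power2_sum_le)
    finally have u: "- (norm (A y))\<^sup>2 - (norm (A (G x)))\<^sup>2 \<le> u"
      by (simp add: u_def linear_diff[OF linear_A])
    have "exp t * (1 - (norm (A y))\<^sup>2 - (norm (A (G x)))\<^sup>2 - t) \<le> exp t * (1 + (u - t))"
      using u by (intro mult_left_mono) auto
    also have "\<dots> \<le> exp t * exp (u - t)"
      by (intro mult_left_mono exp_ge_add_one_self) auto
    finally show ?thesis
      by (simp add: gauss_def u_def flip: exp_add)
  qed
  have "(\<integral>x. exp t * (1 - (norm (A y))\<^sup>2 - (norm (A (G x)))\<^sup>2 - t) \<partial>M) \<le> mixture G y"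
    unfolding mixture_def using assms integrable_gauss_shift le by (intro integral_mono) auto
  moreover have "(\<integral>x. exp t * (1 - (norm (A y))\<^sup>2 - (norm (A (G x)))\<^sup>2 - t) \<partial>M) = exp t"
    using assms by (simp add: prob_space t_def flip: m_def)
  ultimately show ?thesis
    using mixture_pos ln_ge_iff by (simp add: t_def m_def)
qed

text \<open>
  Jensen's inequality under the posterior given \<open>y\<close>, in the tangent form
  \<open>exp u \<ge> exp t * (1 + u - t)\<close>.
\<close>
lemma ln_mixture_diff_le:
  assumes "s > 0"
  shows "ln (mixture G y) - ln (mixture G y')
    \<le> (1 + s) / 2 * (norm (A (y - y')))\<^sup>2 + scatter G y / mixture G y / (2 * s)"
proof -
  define b where "b = (1 + s) / 2 * (norm (A (y - y')))\<^sup>2"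
  \<comment> \<open>The tangent point is the posterior mean given \<open>y\<close> of the lower
    bound for \<open>u\<close>; it makes the averaged linear part collapse to
    \<open>mixture G y\<close>.\<close>
  define t where "t = - b - scatter G y / mixture G y / (2 * s)"
  have le: "exp t * ((1 - b - t) * gauss A (y - G x) - (norm (A (y - G x)))\<^sup>2 * gauss A (y - G x) / (2 * s))
      \<le> gauss A (y' - G x)" for x
  proof -
    define v d where "v = A (y - G x)" and "d = A (y - y')"
    define u where "u = (norm v)\<^sup>2 / 2 - (norm (v - d))\<^sup>2 / 2"
    have y': "A (y' - G x) = v - d"
      by (simp add: v_def d_def flip: linear_diff[OF linear_A])
    \<comment> \<open>Here \<open>u = v \<bullet> d - (norm d)\<^sup>2 / 2\<close>, and this square
      divided by \<open>2 * s\<close> controls the mixed term \<open>v \<bullet> d\<close> from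
      below.\<close>
    have "0 \<le> (norm (s *\<^sub>R d + v))\<^sup>2" by simp
    then have "- b - (norm v)\<^sup>2 / (2 * s) \<le> u"
      using assms unfolding u_def b_def d_def[symmetric]
      by (simp add: power2_norm_eq_inner inner_add_left inner_add_right inner_diff_left inner_diff_right
          inner_commute field_simps)
    then have "exp t * (1 - b - t - (norm v)\<^sup>2 / (2 * s)) \<le> exp t * (1 + (u - t))"
      by (intro mult_left_mono) auto
    also have "\<dots> \<le> exp t * exp (u - t)"
      by (intro mult_left_mono exp_ge_add_one_self) auto
    also have "\<dots> = exp u" by (simp flip: exp_add)
    finally have "exp t * (1 - b - t - (norm v)\<^sup>2 / (2 * s)) * gauss A (y - G x) \<le> exp u * gauss A (y - G x)"
      using gauss_pos by (intro mult_right_mono) (auto simp: less_imp_le)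
    also have "\<dots> = gauss A (y' - G x)"
      by (simp add: gauss_def u_def y' flip: exp_add v_def)
    finally show ?thesis
      by (simp add: algebra_simps v_def)
  qed
  have "exp t * ((1 - b - t) * mixture G y - scatter G y / (2 * s)) 
      = (\<integral>x. exp t * ((1 - b - t) * gauss A (y - G x) - (norm (A (y - G x)))\<^sup>2 * gauss A (y - G x) / (2 * s)) \<partial>M)"
    using integrable_gauss_shift integrable_square_gauss_shift by (simp add: mixture_def scatter_def)
  also have "\<dots> \<le> mixture G y'"
    unfolding mixture_def[of G y'] using integrable_gauss_shift integrable_square_gauss_shift le
    by (intro integral_mono) auto
  finally have "exp t * ((1 - b - t) * mixture G y - scatter G y / (2 * s)) \<le> mixture G y'" .
  moreover have "(1 - b - t) * mixture G y - scatter G y / (2 * s) = mixture G y"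
    using mixture_pos[of y] assms by (simp add: t_def field_simps)
  ultimately have "ln (exp t * mixture G y) \<le> ln (mixture G y')"
    using mixture_pos by (subst ln_le_cancel_iff) auto
  then show ?thesis
    using mixture_pos[of y] by (simp add: ln_mult t_def b_def)
qed

end

section \<open>Entropy and cross entropy of the observations\<close>

lemma square_integrable_observation:
  assumes [measurable]: "G \<in> borel_measurable M" and "integrable M (\<lambda>x. (norm (A (G x)))\<^sup>2)"
  shows "integrable (M \<Otimes>\<^sub>M noise_measure) (\<lambda>(x, e). (norm (A (G x + e)))\<^sup>2)"
proof (rule Bochner_Integration.integrable_bound)
  show "integrable (M \<Otimes>\<^sub>M noise_measure) (\<lambda>z. 2 * (\<lambda>(x, e). (norm (A (G x)))\<^sup>2) z + 2 * (\<lambda>(x, e). (norm (A e))\<^sup>2) z)"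
    using integrable_joint_fst[OF assms(2)] integrable_joint_snd[OF _ integrable_square_gauss]
    by (intro Bochner_Integration.integrable_add integrable_mult_right) auto
  have "(norm (A (u + e)))\<^sup>2 \<le> 2 * (norm (A u))\<^sup>2 + 2 * (norm (A e))\<^sup>2" for u e
  proof -
    have "(norm (A u + A e))\<^sup>2 \<le> (norm (A u) + norm (A e))\<^sup>2"
      by (intro power_mono norm_triangle_ineq) simp
    also have "\<dots> \<le> 2 * (norm (A u))\<^sup>2 + 2 * (norm (A e))\<^sup>2"
      by (rule power2_sum_le)
    finally show ?thesis by (simp add: linear_add[OF linear_A])
  qed
  then show "AE z in M \<Otimes>\<^sub>M noise_measure. norm (case z of (x, e) \<Rightarrow> (norm (A (G x + e)))\<^sup>2)
      \<le> norm (2 * (\<lambda>(x, e). (norm (A (G x)))\<^sup>2) z + 2 * (\<lambda>(x, e). (norm (A e))\<^sup>2) z)"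
    by (auto simp: split_beta')
qed measurable

context
  fixes G K :: "'x \<Rightarrow> 'a"
  assumes G [measurable]: "G \<in> borel_measurable M" and K [measurable]: "K \<in> borel_measurable M"
    and G2: "integrable M (\<lambda>x. (norm (A (G x)))\<^sup>2)" and K2: "integrable M (\<lambda>x. (norm (A (K x)))\<^sup>2)"
begin

text \<open>The logarithm is at most 0 since the mixture is at most 1, and at least a negative
  quadratic by \<open>ln_mixture_ge\<close>; the observation is square integrable. Two maps
  \<open>G\<close> and \<open>K\<close> are allowed because Gibbs' inequality involves the cross
  entropy.\<close>

lemma ln_mixture_joint_integrable:
  "integrable (M \<Otimes>\<^sub>M noise_measure) (\<lambda>(x, e). ln (mixture G (K x + e)))"
proof (rule Bochner_Integration.integrable_bound)
  have [measurable]: "mixture G \<in> borel_measurable borel"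
    by (rule measurable_mixture[OF G])
  show "(\<lambda>(x, e). ln (mixture G (K x + e))) \<in> borel_measurable (M \<Otimes>\<^sub>M noise_measure)"
    by measurable
  define m where "m = (\<integral>x. (norm (A (G x)))\<^sup>2 \<partial>M)"
  show "integrable (M \<Otimes>\<^sub>M noise_measure)
      (\<lambda>z. (\<lambda>(x, e). (norm (A (K x + e)))\<^sup>2) z + (\<lambda>(x, e). m) z)"
    using square_integrable_observation[OF K K2] integrable_joint_fst[of "\<lambda>_. m"]
    by (intro Bochner_Integration.integrable_add) (auto simp: split_beta')
  have "\<bar>ln (mixture G y)\<bar> \<le> \<bar>(norm (A y))\<^sup>2 + m\<bar>" for y
    using ln_mixture_ge[OF G G2, of y] mixture_le_1[OF G, of y] mixture_pos[OF G, of y]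
    by (simp add: m_def)
  then show "AE z in M \<Otimes>\<^sub>M noise_measure. norm (case z of (x, e) \<Rightarrow> ln (mixture G (K x + e)))
      \<le> norm ((\<lambda>(x, e). (norm (A (K x + e)))\<^sup>2) z + (\<lambda>(x, e). m) z)"
    by (auto simp: split_beta')
qed

lemma integrable_ln_mixture: "integrable lborel (\<lambda>y. ln (mixture G y) * mixture K y)"
proof -
  have "(\<lambda>y. ln (mixture G y)) \<in> borel_measurable borel"
    using measurable_mixture[OF G] by (rule borel_measurable_ln)
  from integrable_mult_mixture_iff[OF K this] show ?thesis
    using ln_mixture_joint_integrable by (rule iffD2)
qed

end

text \<open>The logarithm of the kernel contributes \<open>- scatter G y / 2\<close>, whose integral
  is the same for every \<open>G\<close>; what remains is the entropy of the mixture.\<close>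

lemma information_eq_entropy:
  assumes G [measurable]: "G \<in> borel_measurable M" and G2: "integrable M (\<lambda>x. (norm (A (G x)))\<^sup>2)"
  shows "information G = - noise_energy / 2 - (\<integral>y. ln (mixture G y) * mixture G y \<partial>lborel)"
proof -
  have "(\<integral>x. ln (gauss A (y - G x) / mixture G y) * gauss A (y - G x) \<partial>M)
      = - scatter G y / 2 - ln (mixture G y) * mixture G y" for y
  proof -
    have "(\<integral>x. ln (gauss A (y - G x) / mixture G y) * gauss A (y - G x) \<partial>M)
        = (\<integral>x. - ((norm (A (y - G x)))\<^sup>2 * gauss A (y - G x) / 2) - ln (mixture G y) * gauss A (y - G x) \<partial>M)"
      using gauss_pos mixture_pos[OF G, of y]
      by (intro Bochner_Integration.integral_cong) (auto simp: ln_div less_imp_le gauss_def algebra_simps)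
    then show ?thesis
      using integrable_gauss_shift[OF G] integrable_square_gauss_shift[OF G]
      by (simp add: scatter_def mixture_def)
  qed
  then show ?thesis
    unfolding information_def
    using integrable_scatter[OF G] integral_scatter[OF G] integrable_ln_mixture[OF G G G2 G2]
    by simp
qed

text \<open>
  By Gibbs' inequality the entropy of \<open>K(X) + \<epsilon>\<close> is at most its cross entropy relative to
  \<open>G(X) + \<epsilon>\<close>; the same noise is used in both observations. The noise energy enters as a
  bound on the Fisher information of the mixture.
\<close>
lemma information_diff_le:
  assumes G [measurable]: "G \<in> borel_measurable M" and K [measurable]: "K \<in> borel_measurable M"
    and G2: "integrable M (\<lambda>x. (norm (A (G x)))\<^sup>2)" and K2: "integrable M (\<lambda>x. (norm (A (K x)))\<^sup>2)"
    and D2: "integrable M (\<lambda>x. (norm (A (G x - K x)))\<^sup>2)"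
    and s: "s > 0"
  shows "information K - information G
    \<le> (1 + s) / 2 * (noise_mass * (\<integral>x. (norm (A (G x - K x)))\<^sup>2 \<partial>M)) + noise_energy / (2 * s)"
proof -
  let ?J = "M \<Otimes>\<^sub>M noise_measure"
  have [measurable]: "mixture G \<in> borel_measurable borel" "mixture K \<in> borel_measurable borel"
      "scatter G \<in> borel_measurable borel"
    using G K by auto
  \<comment> \<open>Gibbs' inequality from \<open>ln a \<le> a - 1\<close> at the ratio of the
    mixtures. The added difference integrates to 0, both mixtures having mass
    \<open>noise_mass\<close>.\<close>
  have "(\<integral>y. ln (mixture G y) * mixture K y \<partial>lborel) + (\<integral>y. mixture K y - mixture G y \<partial>lborel)
      = (\<integral>y. ln (mixture G y) * mixture K y + (mixture K y - mixture G y) \<partial>lborel)"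
    using integrable_ln_mixture[OF G K G2 K2] integrable_mixture[OF G] integrable_mixture[OF K]
    by (intro Bochner_Integration.integral_add[symmetric] Bochner_Integration.integrable_diff)
  also have "\<dots> \<le> (\<integral>y. ln (mixture K y) * mixture K y \<partial>lborel)"
  proof (rule integral_mono)
    fix y
    have p: "mixture G y > 0" "mixture K y > 0"
      using mixture_pos G K by auto
    then have "(ln (mixture G y) - ln (mixture K y)) * mixture K y \<le> (mixture G y / mixture K y - 1) * mixture K y"
      using ln_le_minus_one[of "mixture G y / mixture K y"]
      by (intro mult_right_mono) (auto simp: ln_div)
    then show "ln (mixture G y) * mixture K y + (mixture K y - mixture G y) \<le> ln (mixture K y) * mixture K y"
      using p by (simp add: algebra_simps)
  qed (use integrable_ln_mixture[OF G K G2 K2] integrable_ln_mixture[OF K K K2 K2]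
      integrable_mixture[OF G] integrable_mixture[OF K] in auto)
  finally have gibbs: "(\<integral>y. ln (mixture G y) * mixture K y \<partial>lborel) \<le> (\<integral>y. ln (mixture K y) * mixture K y \<partial>lborel)"
    using integral_mixture[OF G] integral_mixture[OF K] integrable_mixture[OF G] integrable_mixture[OF K]
    by simp
  \<comment> \<open>The posterior term of \<open>ln_mixture_diff_le\<close>. Integration against
    \<open>mixture G\<close> cancels its denominator and leaves the noise energy.\<close>
  define q where "q y = scatter G y / mixture G y / (2 * s)" for y
  have [measurable]: "q \<in> borel_measurable borel"
    unfolding q_def[abs_def] by measurable
  have q_mix: "(\<lambda>y. q y * mixture G y) = (\<lambda>y. scatter G y / (2 * s))"
    using mixture_pos[OF G] by (auto simp: q_def fun_eq_iff less_le)
  have q: "integrable ?J (\<lambda>(x, e). q (G x + e))"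
    using integrable_scatter[OF G] q_mix by (subst integrable_mult_mixture_iff[OF G, symmetric]) auto
  have q_int: "(\<integral>(x, e). q (G x + e) \<partial>?J) = noise_energy / (2 * s)"
    using integral_scatter[OF G] q_mix by (subst integral_mult_mixture[OF G, symmetric]) auto
  have d: "integrable ?J (\<lambda>(x, e). (norm (A (G x - K x)))\<^sup>2)"
    using D2 by (rule integrable_joint_fst)
  note l = ln_mixture_joint_integrable[OF G G G2 G2] ln_mixture_joint_integrable[OF G K G2 K2]
  have "information K - information G
      \<le> (\<integral>y. ln (mixture G y) * mixture G y \<partial>lborel) - (\<integral>y. ln (mixture G y) * mixture K y \<partial>lborel)"
    using gibbs by (simp add: information_eq_entropy G K G2 K2)
  also have "\<dots> = (\<integral>(x, e). ln (mixture G (G x + e)) \<partial>?J) - (\<integral>(x, e). ln (mixture G (K x + e)) \<partial>?J)"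
    by (simp add: integral_mult_mixture G K)
  also have "\<dots> = (\<integral>z. (\<lambda>(x, e). ln (mixture G (G x + e))) z - (\<lambda>(x, e). ln (mixture G (K x + e))) z \<partial>?J)"
    by (rule Bochner_Integration.integral_diff[OF l, symmetric])
  also have "\<dots> \<le> (\<integral>z. (1 + s) / 2 * (\<lambda>(x, e). (norm (A (G x - K x)))\<^sup>2) z + (\<lambda>(x, e). q (G x + e)) z \<partial>?J)"
  proof (rule integral_mono)
    \<comment> \<open>The common noise cancels in the difference of the two observations, leaving
      \<open>G x - K x\<close>.\<close>
    show "(\<lambda>(x, e). ln (mixture G (G x + e))) z - (\<lambda>(x, e). ln (mixture G (K x + e))) z
        \<le> (1 + s) / 2 * (\<lambda>(x, e). (norm (A (G x - K x)))\<^sup>2) z + (\<lambda>(x, e). q (G x + e)) z" for z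
      using ln_mixture_diff_le[OF G s, of "G (fst z) + snd z" "K (fst z) + snd z"]
      by (simp add: split_beta' q_def)
  qed (rule Bochner_Integration.integrable_diff[OF l]
      Bochner_Integration.integrable_add[OF integrable_mult_right[OF d] q])+
  also have "\<dots> = (1 + s) / 2 * (\<integral>(x, e). (norm (A (G x - K x)))\<^sup>2 \<partial>?J) + (\<integral>(x, e). q (G x + e) \<partial>?J)"
    by (subst Bochner_Integration.integral_add[OF integrable_mult_right[OF d] q]) simp
  finally show ?thesis
    by (simp add: q_int integral_joint_fst[OF D2])
qed

text \<open>\<open>information_diff_le\<close> in both directions. A strictly positive bound
  \<open>r\<close> replaces the mean square distance itself, which may be zero, so that
  \<open>1 / sqrt r\<close> is an admissible parameter; it turns both \<open>s * r\<close> and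
  \<open>1 / s\<close> into \<open>sqrt r\<close>.\<close>

lemma abs_information_diff_le:
  assumes G [measurable]: "G \<in> borel_measurable M" and K [measurable]: "K \<in> borel_measurable M"
    and G2: "integrable M (\<lambda>x. (norm (A (G x)))\<^sup>2)" and K2: "integrable M (\<lambda>x. (norm (A (K x)))\<^sup>2)"
    and D2: "(\<integral>\<^sup>+x. ennreal ((norm (A (G x - K x)))\<^sup>2) \<partial>M) \<le> ennreal r" and r: "r > 0"
  shows "\<bar>information G - information K\<bar> \<le> (noise_mass * (r + sqrt r) + noise_energy * sqrt r) / 2"
proof -
  define s where "s = 1 / sqrt r"
  have s: "s > 0" "s * r = sqrt r" "noise_energy / (2 * s) = noise_energy * sqrt r / 2"
    using r by (simp_all add: s_def real_div_sqrt)
  define e where "e = (\<integral>x. (norm (A (G x - K x)))\<^sup>2 \<partial>M)"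
  have int: "integrable M (\<lambda>x. (norm (A (G x - K x)))\<^sup>2)"
    using D2 by (intro integrableI_bounded) (auto simp: top_unique le_less_trans)
  have "e \<le> r"
    using D2 r by (subst (asm) nn_integral_eq_integral[OF int]) (auto simp: e_def)
  then have "(1 + s) / 2 * (noise_mass * e) \<le> (1 + s) / 2 * (noise_mass * r)"
    using s noise_mass_nonneg by (intro mult_left_mono) auto
  also have "\<dots> = noise_mass * (r + s * r) / 2"
    by (simp add: algebra_simps)
  finally have e: "(1 + s) / 2 * (noise_mass * e) \<le> noise_mass * (r + sqrt r) / 2"
    unfolding s(2) .
  have swap: "norm (A (K x - G x)) = norm (A (G x - K x))" for x
    by (metis linear_diff[OF linear_A] norm_minus_commute)
  have "information K - information G \<le> (1 + s) / 2 * (noise_mass * e) + noise_energy / (2 * s)"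
    unfolding e_def by (rule information_diff_le[OF G K G2 K2 int s(1)])
  moreover have "information G - information K \<le> (1 + s) / 2 * (noise_mass * e) + noise_energy / (2 * s)"
    using information_diff_le[OF K G K2 G2 _ s(1)] int by (simp add: swap e_def)
  ultimately show ?thesis
    using e unfolding s(3) by argo
qed

end

subsection \<open>Stability and convergence of maximizers\<close>

text \<open>Truncate at a level \<open>R\<close>: the truncated part converges by dominated
  convergence, and the excess is at most \<open>(Z n x)\<^sup>2 / R\<close>, whose integral is small
  uniformly in \<open>n\<close>.\<close>

lemma (in finite_measure) integral_tendsto_0_of_second_moments:
  fixes Z :: "nat \<Rightarrow> 'a \<Rightarrow> real"
  assumes [measurable]: "\<And>n. Z n \<in> borel_measurable M"
    and nonneg: "\<And>n x. Z n x \<ge> 0"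
    and lim: "\<And>x. x \<in> space M \<Longrightarrow> (\<lambda>n. Z n x) \<longlonglongrightarrow> 0"
    and Z2: "\<And>n. integrable M (\<lambda>x. (Z n x)\<^sup>2)" "\<And>n. (\<integral>x. (Z n x)\<^sup>2 \<partial>M) \<le> C"
  shows "(\<lambda>n. \<integral>x. Z n x \<partial>M) \<longlonglongrightarrow> 0"
proof (rule LIMSEQ_I)
  fix e :: real assume e: "e > 0"
  have C: "C \<ge> 0"
    using Z2(2)[of 0] by (meson Bochner_Integration.integral_nonneg order_trans zero_le_power2)
  \<comment> \<open>Using \<open>C + 1\<close> keeps \<open>R\<close> positive when
    \<open>C = 0\<close> and makes \<open>C / R < e / 2\<close> strict.\<close>
  define R where "R = 2 * (C + 1) / e"
  have R: "R > 0" "C / R < e / 2"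
    using C e by (simp_all add: R_def field_simps)
  have min_int: "integrable M (\<lambda>x. min (Z n x) R)" for n
    using nonneg[of n] R by (intro integrable_const_bound[of _ R]) auto
  have "(\<lambda>n. \<integral>x. min (Z n x) R \<partial>M) \<longlonglongrightarrow> (\<integral>x. 0 \<partial>M)"
  proof (rule integral_dominated_convergence[where w = "\<lambda>_. R"])
    show "AE x in M. (\<lambda>n. min (Z n x) R) \<longlonglongrightarrow> 0"
    proof (rule AE_I2)
      fix x assume "x \<in> space M"
      from tendsto_min[OF lim[OF this] tendsto_const, of R] show "(\<lambda>n. min (Z n x) R) \<longlonglongrightarrow> 0"
        using R by simp
    qed
    show "AE x in M. norm (min (Z n x) R) \<le> R" for n
      using nonneg[of n] R by auto
  qed auto
  then have "\<forall>\<^sub>F n in sequentially. (\<integral>x. min (Z n x) R \<partial>M) < e / 2"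
    using e by (intro order_tendstoD(2)[of _ 0]) auto
  moreover have "norm ((\<integral>x. Z n x \<partial>M) - 0) < e" if n: "(\<integral>x. min (Z n x) R \<partial>M) < e / 2" for n
  proof -
    have le: "Z n x \<le> min (Z n x) R + (Z n x)\<^sup>2 / R" for x
    proof (cases "Z n x \<le> R")
      case False
      then have "Z n x * R \<le> Z n x * Z n x"
        using nonneg[of n x] by (intro mult_left_mono) auto
      then show ?thesis
        using False R by (simp add: min_def field_simps power2_eq_square add_increasing)
    qed (use R in simp)
    have "(\<integral>x. Z n x \<partial>M) \<le> (\<integral>x. min (Z n x) R + (Z n x)\<^sup>2 / R \<partial>M)"
      using min_int Z2(1) nonneg le by (intro integral_mono' order_trans[OF nonneg le]) auto
    also have "\<dots> = (\<integral>x. min (Z n x) R \<partial>M) + (\<integral>x. (Z n x)\<^sup>2 \<partial>M) / R"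
      using min_int Z2(1) by simp
    also have "\<dots> < e / 2 + e / 2"
      using n R(2) divide_right_mono[OF Z2(2)[of n] less_imp_le[OF R(1)]] by linarith
    finally show ?thesis
      using nonneg by simp
  qed
  ultimately show "\<exists>n0. \<forall>n\<ge>n0. norm ((\<integral>x. Z n x \<partial>M) - 0) < e"
    unfolding eventually_sequentially by blast
qed

section \<open>Whitening by the inverse root of the covariance\<close>

definition whiten :: "real^'p^'p \<Rightarrow> real^'p \<Rightarrow> real^'p" where
  "whiten \<Gamma> v = matrix_inv (spd_sqrt \<Gamma>) *v v"

lemma weighted_norm_whiten: "weighted_norm \<Gamma> v = norm (whiten \<Gamma> v)"
  by (simp add: weighted_norm_def whiten_def)

lemma noise_whiten:
  assumes "spd_matrix \<Gamma>"
  shows "noise (whiten \<Gamma>)"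
proof (rule noise.intro)
  show "linear (whiten \<Gamma>)"
    unfolding whiten_def[abs_def] by simp
  show "inj (whiten \<Gamma>)"
    using matrix_inv_inverse(1)[OF spd_matrix_invertible[OF spd_sqrt(1)[OF assms]]]
    unfolding whiten_def[abs_def] by (metis matrix_left_invertible_injective)
qed

text \<open>
  The normalising factor of the Gaussian cancels inside the logarithm, so it enters only as a
  multiplicative constant and need not be evaluated.
\<close>
lemma expected_information_gain_eq:
  fixes \<Gamma> :: "real^'p^'p"
  assumes "prob_space \<mu>" "spd_matrix \<Gamma>"
  shows "expected_information_gain \<mu> \<Gamma> H d = 1 / sqrt ((2 * pi) ^ CARD('p) * det \<Gamma>)
    * gaussian_mixture.information \<mu> (whiten \<Gamma>) (\<lambda>x. H x d)"
proof -
  interpret gaussian_mixture \<mu> "whiten \<Gamma>"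
    using assms by (intro gaussian_mixture.intro noise_whiten)
  define k where "k = 1 / sqrt ((2 * pi) ^ CARD('p) * det \<Gamma>)"
  have lik: "likelihood \<Gamma> H y x d = k * gauss (whiten \<Gamma>) (y - H x d)" for y x
    by (simp add: likelihood_def gaussian_density_def gauss_def k_def
        weighted_norm_square[OF assms(2)] flip: weighted_norm_whiten)
  have evi: "evidence \<mu> \<Gamma> H y d = k * mixture (\<lambda>x. H x d) y" for y
    by (simp add: evidence_def lik mixture_def)
  have "ln (likelihood \<Gamma> H y x d / evidence \<mu> \<Gamma> H y d) * likelihood \<Gamma> H y x d
      = k * (ln (gauss (whiten \<Gamma>) (y - H x d) / mixture (\<lambda>x. H x d) y) * gauss (whiten \<Gamma>) (y - H x d))" for x y
    \<comment> \<open>For \<open>k = 0\<close> both sides are 0; otherwise \<open>k\<close> cancels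
      in the quotient.\<close>
    unfolding lik evi by (cases "k = 0") auto
  then show ?thesis
    by (simp add: expected_information_gain_def information_def k_def)
qed

theorem theorem4p4:
  fixes \<mu>0 :: "'x :: {banach, second_countable_topology} measure"
    and \<Gamma> :: "real^'p^'p"
    and G :: "'x \<Rightarrow> 'd :: metric_space \<Rightarrow> real^'p"
    and GN :: "nat \<Rightarrow> 'x \<Rightarrow> 'd \<Rightarrow> real^'p"
    and \<psi> :: "nat \<Rightarrow> real"
    and C\<^sub>G C\<^sub>1 :: real
  assumes prior: "prob_space \<mu>0" "sets \<mu>0 = sets borel"
    and noise_cov: "spd_matrix \<Gamma>"
    and meas: "\<And>d. (\<lambda>x. G x d) \<in> borel_measurable \<mu>0"
      "\<And>N d. N \<ge> 1 \<Longrightarrow> (\<lambda>x. GN N x d) \<in> borel_measurable \<mu>0"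
    and moments: "C\<^sub>G > 0"
      "(SUP d. \<integral>\<^sup>+x. ennreal (weighted_norm \<Gamma> (G x d) ^ 4) \<partial>\<mu>0) \<le> ennreal C\<^sub>G"
      "\<And>N. N \<ge> 1 \<Longrightarrow>
         (SUP d. \<integral>\<^sup>+x. ennreal (weighted_norm \<Gamma> (GN N x d) ^ 4) \<partial>\<mu>0) \<le> ennreal C\<^sub>G"
    and approx: "C\<^sub>1 > 0" "\<And>N. N \<ge> 1 \<Longrightarrow> \<psi> N \<ge> 0" "\<psi> \<longlonglongrightarrow> 0"
      "\<And>N d. N \<ge> 1 \<Longrightarrow>
         (\<integral>\<^sup>+x. ennreal ((weighted_norm \<Gamma> (G x d - GN N x d))\<^sup>2) \<partial>\<mu>0) < ennreal (C\<^sub>1 * \<psi> N)"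
    and cont: "\<And>x. continuous_on UNIV (\<lambda>d. G x d)"
  shows "(\<exists>C>0. \<forall>\<^sub>F N in sequentially.
            (SUP d. ereal \<bar>expected_information_gain \<mu>0 \<Gamma> G d
                           - expected_information_gain \<mu>0 \<Gamma> (GN N) d\<bar>) \<le> ereal (C * sqrt (\<psi> N)))
       \<and> (\<forall>dstar r dlim.
            (\<forall>N\<ge>1. is_arg_max (expected_information_gain \<mu>0 \<Gamma> (GN N)) (\<lambda>_. True) (dstar N)) \<longrightarrow>
            strict_mono r \<longrightarrow> (dstar \<circ> r) \<longlonglongrightarrow> dlim \<longrightarrow>
            is_arg_max (expected_information_gain \<mu>0 \<Gamma> G) (\<lambda>_. True) dlim)"
proof -
  interpret gaussian_mixture \<mu>0 "whiten \<Gamma>"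
    using prior(1) noise_cov by (intro gaussian_mixture.intro noise_whiten)
  note [measurable] = meas
  let ?U = "expected_information_gain \<mu>0 \<Gamma> G" and ?UN = "\<lambda>N. expected_information_gain \<mu>0 \<Gamma> (GN N)"
  define k where "k = 1 / sqrt ((2 * pi) ^ CARD('p) * det \<Gamma>)"
  have gain: "expected_information_gain \<mu>0 \<Gamma> H d = k * information (\<lambda>x. H x d)"
    for H :: "'x \<Rightarrow> 'd \<Rightarrow> real^'p" and d
    unfolding k_def by (rule expected_information_gain_eq[OF prior(1) noise_cov])
  define w where "w v = norm (whiten \<Gamma> v)" for v
  have [measurable]: "w \<in> borel_measurable borel"
    unfolding w_def[abs_def] by measurable

  \<comment> \<open>Fourth and second moments of the forward maps\<close>
  have fourth: "integrable \<mu>0 (\<lambda>x. w (H x) ^ 4) \<and> (\<integral>x. w (H x) ^ 4 \<partial>\<mu>0) \<le> C\<^sub>G"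
    if [measurable]: "H \<in> borel_measurable \<mu>0" and le: "(\<integral>\<^sup>+x. ennreal (w (H x) ^ 4) \<partial>\<mu>0) \<le> ennreal C\<^sub>G" for H
  proof -
    have int: "integrable \<mu>0 (\<lambda>x. w (H x) ^ 4)"
      using le by (intro integrableI_nonneg) (auto simp: top_unique le_less_trans)
    moreover have "(\<integral>x. w (H x) ^ 4 \<partial>\<mu>0) \<le> C\<^sub>G"
      using le moments(1) by (subst (asm) nn_integral_eq_integral[OF int]) auto
    ultimately show ?thesis ..
  qed
  have second: "integrable \<mu>0 (\<lambda>x. (w (H x))\<^sup>2)"
    if [measurable]: "H \<in> borel_measurable \<mu>0" and int: "integrable \<mu>0 (\<lambda>x. w (H x) ^ 4)" for H
  proof (rule Bochner_Integration.integrable_bound)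
    show "integrable \<mu>0 (\<lambda>x. 1 + w (H x) ^ 4)"
      using int by simp
    have "t\<^sup>2 \<le> 1 + t ^ 4" for t :: real
    proof -
      have "2 * t\<^sup>2 \<le> t ^ 4 + 1"
        using zero_le_power2[of "t\<^sup>2 - 1"] by (simp add: power2_diff flip: power_mult)
      then show ?thesis
        using zero_le_power2[of t] by linarith
    qed
    then show "AE x in \<mu>0. norm ((w (H x))\<^sup>2) \<le> norm (1 + w (H x) ^ 4)"
      by auto
  qed measurable
  have G4: "integrable \<mu>0 (\<lambda>x. w (G x d) ^ 4)" "(\<integral>x. w (G x d) ^ 4 \<partial>\<mu>0) \<le> C\<^sub>G" for d
    using fourth[of "\<lambda>x. G x d"] moments(2) meas(1)
    by (auto simp: SUP_le_iff weighted_norm_whiten w_def)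
  have G2: "integrable \<mu>0 (\<lambda>x. (w (G x d))\<^sup>2)" for d
    using second[of "\<lambda>x. G x d"] G4(1) meas(1) by blast
  have GN2: "integrable \<mu>0 (\<lambda>x. (w (GN N x d))\<^sup>2)" if "N \<ge> 1" for N d
    using second[of "\<lambda>x. GN N x d"] fourth[of "\<lambda>x. GN N x d"] moments(3)[OF that] meas(2)[OF that]
    by (auto simp: SUP_le_iff weighted_norm_whiten w_def)
  \<comment> \<open>The bound of \<open>abs_information_diff_le\<close> at
    \<open>r = C\<^sub>1 * \<psi> N\<close> after replacing \<open>\<psi> N\<close> by the larger
    \<open>sqrt (\<psi> N)\<close>, which is legitimate once \<open>\<psi> N \<le> 1\<close>. The
    summand 1 makes the constant positive in every case.\<close>
  define C where "C = \<bar>k\<bar> * ((noise_mass * (C\<^sub>1 + sqrt C\<^sub>1) + noise_energy * sqrt C\<^sub>1) / 2) + 1"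
  have C: "C > 0"
    using noise_mass_nonneg noise_energy_nonneg approx(1) by (simp add: C_def add_nonneg_pos)
  have bound: "\<bar>?U d - ?UN N d\<bar> \<le> C * sqrt (\<psi> N)" if N: "N \<ge> 1" and small: "\<psi> N \<le> 1" for N d
  proof -
    \<comment> \<open>The strict inequality in the approximation hypothesis excludes
      \<open>\<psi> N = 0\<close>, since no nonnegative integral lies below 0.\<close>
    have pos: "\<psi> N > 0"
    proof (rule ccontr)
      assume "\<not> \<psi> N > 0"
      then have "ennreal (C\<^sub>1 * \<psi> N) = 0"
        using approx(1) approx(2)[OF N] by simp
      with approx(4)[OF N, of d] show False by simp
    qed
    have "\<psi> N \<le> sqrt (\<psi> N)"
      using pos small by (intro real_le_rsqrt) (simp add: power2_eq_square mult_left_le)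
    then have "C\<^sub>1 * \<psi> N \<le> C\<^sub>1 * sqrt (\<psi> N)"
      using approx(1) by (intro mult_left_mono) auto
    then have "noise_mass * (C\<^sub>1 * \<psi> N) \<le> noise_mass * (C\<^sub>1 * sqrt (\<psi> N))"
      using noise_mass_nonneg by (rule mult_left_mono)
    moreover have "\<bar>information (\<lambda>x. G x d) - information (\<lambda>x. GN N x d)\<bar>
        \<le> (noise_mass * (C\<^sub>1 * \<psi> N + sqrt (C\<^sub>1 * \<psi> N)) + noise_energy * sqrt (C\<^sub>1 * \<psi> N)) / 2"
      using approx(1) approx(4)[OF N, of d] pos meas(1) meas(2)[OF N] G2[of d] GN2[OF N, of d]
      by (intro abs_information_diff_le) (auto simp: weighted_norm_whiten w_def less_imp_le)
    ultimately have "\<bar>information (\<lambda>x. G x d) - information (\<lambda>x. GN N x d)\<bar>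
        \<le> (noise_mass * (C\<^sub>1 + sqrt C\<^sub>1) + noise_energy * sqrt C\<^sub>1) / 2 * sqrt (\<psi> N)"
      by (simp add: real_sqrt_mult algebra_simps)
    then have "\<bar>k\<bar> * \<bar>information (\<lambda>x. G x d) - information (\<lambda>x. GN N x d)\<bar>
        \<le> \<bar>k\<bar> * ((noise_mass * (C\<^sub>1 + sqrt C\<^sub>1) + noise_energy * sqrt C\<^sub>1) / 2 * sqrt (\<psi> N))"
      by (rule mult_left_mono) simp
    also have "\<dots> \<le> C * sqrt (\<psi> N)"
      using pos by (simp add: C_def algebra_simps)
    finally show ?thesis
      by (simp add: gain abs_mult flip: right_diff_distrib)
  qed
  have small: "\<forall>\<^sub>F N in sequentially. N \<ge> 1 \<and> \<psi> N \<le> 1"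
    using eventually_ge_at_top[of 1] order_tendstoD(2)[OF approx(3) zero_less_one]
    by eventually_elim auto
  have "\<forall>\<^sub>F N in sequentially. (SUP d. ereal \<bar>?U d - ?UN N d\<bar>) \<le> ereal (C * sqrt (\<psi> N))"
    using small by eventually_elim (auto intro!: SUP_least bound)

  \<comment> \<open>Limits of maximizers of the surrogates\<close>
  moreover have "is_arg_max ?U (\<lambda>_. True) dlim"
    if max: "\<forall>N\<ge>1. is_arg_max (?UN N) (\<lambda>_. True) (dstar N)"
      and r: "strict_mono r" and dlim: "(dstar \<circ> r) \<longlonglongrightarrow> dlim" for dstar r dlim
  proof -
    let ?D = "\<lambda>n x. G x (dstar (r n)) - G x dlim"
    define e where "e n = (\<integral>x. (w (?D n x))\<^sup>2 \<partial>\<mu>0)" for n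
    \<comment> \<open>The triangle inequality followed by \<open>power2_sum_le\<close> twice, giving
      the factor 8 on each term. The integrals are then at most \<open>16 * C\<^sub>G\<close>
      uniformly in \<open>n\<close>: these are second moments of the squared distance, as the
      truncation lemma requires.\<close>
    have D4: "w (?D n x) ^ 4 \<le> 8 * w (G x (dstar (r n))) ^ 4 + 8 * w (G x dlim) ^ 4" for n x
    proof -
      have tri: "w (?D n x) \<le> w (G x (dstar (r n))) + w (G x dlim)"
        by (simp add: w_def linear_diff[OF linear_A] norm_triangle_ineq4)
      then have "(w (?D n x))\<^sup>2 \<le> 2 * (w (G x (dstar (r n))))\<^sup>2 + 2 * (w (G x dlim))\<^sup>2"
        by (intro order_trans[OF power_mono[OF tri] power2_sum_le]) (simp add: w_def)
      then have "((w (?D n x))\<^sup>2)\<^sup>2 \<le> (2 * (w (G x (dstar (r n))))\<^sup>2 + 2 * (w (G x dlim))\<^sup>2)\<^sup>2"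
        by (rule power_mono) simp
      then show ?thesis
        using power2_sum_le[of "2 * (w (G x (dstar (r n))))\<^sup>2" "2 * (w (G x dlim))\<^sup>2"]
        by (simp add: power_mult_distrib flip: power_mult)
    qed
    have D4_int: "integrable \<mu>0 (\<lambda>x. w (?D n x) ^ 4)" for n
    proof (rule Bochner_Integration.integrable_bound)
      show "integrable \<mu>0 (\<lambda>x. 8 * w (G x (dstar (r n))) ^ 4 + 8 * w (G x dlim) ^ 4)"
        by (intro Bochner_Integration.integrable_add integrable_mult_right G4(1))
      show "AE x in \<mu>0. norm (w (?D n x) ^ 4) \<le> norm (8 * w (G x (dstar (r n))) ^ 4 + 8 * w (G x dlim) ^ 4)"
        using order_trans[OF D4 abs_ge_self] by simp
    qed measurable
    have "(\<integral>x. w (?D n x) ^ 4 \<partial>\<mu>0) \<le> 16 * C\<^sub>G" for n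
    proof -
      have "(\<integral>x. w (?D n x) ^ 4 \<partial>\<mu>0) \<le> (\<integral>x. 8 * w (G x (dstar (r n))) ^ 4 + 8 * w (G x dlim) ^ 4 \<partial>\<mu>0)"
        by (intro integral_mono D4 D4_int Bochner_Integration.integrable_add integrable_mult_right G4(1))
      then show ?thesis
        using G4[of "dstar (r n)"] G4[of dlim] by simp
    qed
    moreover have "(\<lambda>n. (w (?D n x))\<^sup>2) \<longlonglongrightarrow> 0" for x
    proof -
      have "(\<lambda>n. G x (dstar (r n))) \<longlonglongrightarrow> G x dlim"
        using continuous_on_tendsto_compose[OF cont dlim] by (simp add: o_def)
      then have "(\<lambda>n. ?D n x) \<longlonglongrightarrow> 0"
        by (simp add: LIM_zero)
      then have "(\<lambda>n. whiten \<Gamma> (?D n x)) \<longlonglongrightarrow> whiten \<Gamma> 0"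
        by (rule bounded_linear.tendsto[OF linear_A[unfolded linear_conv_bounded_linear]])
      then show ?thesis
        using tendsto_power[OF tendsto_norm, of _ "whiten \<Gamma> 0" _ 2] by (simp add: w_def linear_0[OF linear_A])
    qed
    ultimately have "e \<longlonglongrightarrow> 0"
      unfolding e_def using D4_int
      by (intro integral_tendsto_0_of_second_moments[where C = "16 * C\<^sub>G"]) (auto simp flip: power_mult)
    \<comment> \<open>The mean square distance \<open>e n\<close> may be zero; the added null
      sequence makes it strictly positive for \<open>abs_information_diff_le\<close>.\<close>
    define q where "q n = e n + inverse (real (Suc n))" for n
    have q: "q \<longlonglongrightarrow> 0"
      using tendsto_add[OF \<open>e \<longlonglongrightarrow> 0\<close> LIMSEQ_inverse_real_of_nat] by (simp add: q_def[abs_def])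
    have "\<bar>?U (dstar (r n)) - ?U dlim\<bar>
        \<le> \<bar>k\<bar> * ((noise_mass * (q n + sqrt (q n)) + noise_energy * sqrt (q n)) / 2)" for n
    proof -
      have "e n \<ge> 0"
        unfolding e_def by (rule Bochner_Integration.integral_nonneg) simp
      moreover have "(\<integral>\<^sup>+x. ennreal ((w (?D n x))\<^sup>2) \<partial>\<mu>0) = ennreal (e n)"
        unfolding e_def using second[of "?D n"] D4_int[of n] meas(1)
        by (intro nn_integral_eq_integral) auto
      ultimately have "\<bar>information (\<lambda>x. G x (dstar (r n))) - information (\<lambda>x. G x dlim)\<bar>
          \<le> (noise_mass * (q n + sqrt (q n)) + noise_energy * sqrt (q n)) / 2"
        using G2 meas(1) unfolding q_def
        by (intro abs_information_diff_le) (auto simp: w_def intro!: ennreal_leI add_nonneg_pos)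
      then have "\<bar>k\<bar> * \<bar>information (\<lambda>x. G x (dstar (r n))) - information (\<lambda>x. G x dlim)\<bar>
          \<le> \<bar>k\<bar> * ((noise_mass * (q n + sqrt (q n)) + noise_energy * sqrt (q n)) / 2)"
        by (rule mult_left_mono) simp
      then show ?thesis
        by (simp add: gain abs_mult flip: right_diff_distrib)
    qed
    then have "\<forall>\<^sub>F n in sequentially. norm (?U (dstar (r n)) - ?U dlim)
        \<le> \<bar>k\<bar> * ((noise_mass * (q n + sqrt (q n)) + noise_energy * sqrt (q n)) / 2)"
      by (simp add: always_eventually)
    moreover have "(\<lambda>n. \<bar>k\<bar> * ((noise_mass * (q n + sqrt (q n)) + noise_energy * sqrt (q n)) / 2)) \<longlonglongrightarrow>
        \<bar>k\<bar> * ((noise_mass * (0 + sqrt 0) + noise_energy * sqrt 0) / 2)"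
      by (intro tendsto_intros q) simp
    then have "(\<lambda>n. \<bar>k\<bar> * ((noise_mass * (q n + sqrt (q n)) + noise_energy * sqrt (q n)) / 2)) \<longlonglongrightarrow> 0"
      by simp
    ultimately have "(\<lambda>n. ?U (dstar (r n)) - ?U dlim) \<longlonglongrightarrow> 0"
      by (rule Lim_null_comparison)
    then have U_lim: "(\<lambda>n. ?U (dstar (r n))) \<longlonglongrightarrow> ?U dlim"
      by (rule LIM_zero_cancel)
    \<comment> \<open>Pass from \<open>?U\<close> to the surrogate at \<open>d\<close>, use that
      \<open>dstar (r n)\<close> maximises the surrogate, and return to \<open>?U\<close>. The two
      passages cost \<open>2 * C * sqrt (\<psi> (r n))\<close>, which vanishes in the limit, while
      \<open>?U (dstar (r n))\<close> tends to \<open>?U dlim\<close>.\<close>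
    have "?U d \<le> ?U dlim" for d
    proof -
      have "(\<lambda>n. \<psi> (r n)) \<longlonglongrightarrow> 0"
        using LIMSEQ_subseq_LIMSEQ[OF approx(3) r] by (simp add: o_def)
      then have "(\<lambda>n. ?U (dstar (r n)) + 2 * C * sqrt (\<psi> (r n))) \<longlonglongrightarrow> ?U dlim + 2 * C * sqrt 0"
        by (intro tendsto_intros U_lim)
      moreover have "\<forall>\<^sub>F n in sequentially. ?U d \<le> ?U (dstar (r n)) + 2 * C * sqrt (\<psi> (r n))"
        using eventually_subseq[OF r small]
      proof eventually_elim
        case (elim n)
        then have "?UN (r n) d \<le> ?UN (r n) (dstar (r n))"
          using max by (auto simp: is_arg_max_def not_less)
        then show ?case
          using bound[of "r n" d] bound[of "r n" "dstar (r n)"] elim by (simp add: abs_le_iff)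
      qed
      ultimately show ?thesis
        using tendsto_lowerbound[of _ "?U dlim + 2 * C * sqrt 0" sequentially "?U d"] by simp
    qed
    then show ?thesis
      by (simp add: is_arg_max_def not_less)
  qed
  ultimately show ?thesis
    using C by blast
qed

end
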